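(* Let $N\ge2$, $p_c=\frac{2N}{N+1}$, and for $p>p_c$ let $B_p(x,t;M)$ denote the fundamental solution of $\partial_t u=\mathrm{div}(|\nabla u|^{p-2}\nabla u)$ in $\mathbb{R}^N$ with mass $M>0$. Then as $p\downarrow p_c$, for all $t>0$, $$\lim_{p\to p_c}B_p(\cdot,t;M)=M\,\delta$$ in the sense of measures in $\mathbb{R}^N$, where $\delta$ is the unit Dirac mass at $x=0$. Moreover, for $\varepsilon=p-p_c>0$ small we have the uniform estimate $$B_p(x,1;M)\le C\,\bigl(\varepsilon\,|x|^{-p}\bigr)^{\frac1{2-p}},\qquad x\neq 0,$$ with $C$ independent of $\varepsilon$ and $x$, which implies uniform convergence to zero for $x$ away from the origin as $p\to p_c$.
   Context: For $p_c<p<2$ the fundamental (Barenblatt) solution with mass $M$ is $B_p(x,t;M)=t^{-\alpha}F(x\,t^{-\beta})$ with $$\alpha=\frac{N}{p+N(p-2)},\qquad \beta=\frac{1}{p+N(p-2)},\qquad F(y)=\Bigl(C_p+\tfrac{2-p}{p}\,\beta^{\frac1{p-1}}|y|^{\frac p{p-1}}\Bigr)^{-\frac{p-1}{2-p}},$$ where $C_p>0$ is determined by $\int_{\mathbb{R}^N}B_p(x,t;M)\,dx=M$. *)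

theory Defs
  imports "HOL-Probability.Probability"
begin

definition p_crit :: "nat \<Rightarrow> real" where
  "p_crit N = 2 * real N / (real N + 1)"

definition barenblatt_alpha :: "nat \<Rightarrow> real \<Rightarrow> real" where
  "barenblatt_alpha N p = real N / (p + real N * (p - 2))"

definition barenblatt_beta :: "nat \<Rightarrow> real \<Rightarrow> real" where
  "barenblatt_beta N p = 1 / (p + real N * (p - 2))"

text \<open>
  The self-similar profile in the fast diffusion range.  The function
  t powr (- alpha) * F (x / t powr beta) solves the p-Laplacian evolution equation iff
  div (norm (grad F) powr (p - 2) * grad F) = - beta * div (y F).  For a radially decreasing F the
  flux identity norm (grad F) powr (p - 2) * grad F = - beta * y * F is an ordinary differential
  equation in the radius, and the formula below is its solution; C is the constant of integration.
  All four definitions that follow are meant for p with p_crit N < p < 2, where N is the dimension.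
\<close>

definition barenblatt_profile :: "real \<Rightarrow> real \<Rightarrow> real ^ 'n \<Rightarrow> real" where
  "barenblatt_profile p C y =
     (C + (2 - p) / p * barenblatt_beta CARD('n) p powr (1 / (p - 1)) * norm y powr (p / (p - 1)))
       powr (- ((p - 1) / (2 - p)))"

definition barenblatt_aux :: "real \<Rightarrow> real \<Rightarrow> real ^ 'n \<Rightarrow> real \<Rightarrow> real" where
  "barenblatt_aux p C x t =
     t powr (- barenblatt_alpha CARD('n) p) *
       barenblatt_profile p C (t powr (- barenblatt_beta CARD('n) p) *\<^sub>R x)"

definition barenblatt_const :: "'n::finite itself \<Rightarrow> real \<Rightarrow> real \<Rightarrow> real" where
  "barenblatt_const _ p M =
     (THE C. 0 < C \<and> (\<forall>t>0. has_bochner_integral lborel (\<lambda>x :: real ^ 'n. barenblatt_aux p C x t) M))"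

definition barenblatt :: "real \<Rightarrow> real ^ 'n \<Rightarrow> real \<Rightarrow> real \<Rightarrow> real" where
  "barenblatt p x t M = barenblatt_aux p (barenblatt_const TYPE('n) p M) x t"

text \<open>
  Narrow convergence of measures along a filter: test functions are all bounded continuous
  functions.  In particular it implies convergence against compactly supported test functions.
\<close>

definition measures_tendsto ::
    "('i \<Rightarrow> 'a::topological_space measure) \<Rightarrow> 'a measure \<Rightarrow> 'i filter \<Rightarrow> bool" where
  "measures_tendsto \<mu> \<nu> F \<longleftrightarrow>
     (\<forall>f :: 'a \<Rightarrow> real. continuous_on UNIV f \<longrightarrow> bounded (range f) \<longrightarrow>
        ((\<lambda>i. \<integral>x. f x \<partial>\<mu> i) \<longlongrightarrow> (\<integral>x. f x \<partial>\<nu>)) F)"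

subsection \<open>The constant in the profile is well defined\<close>

lemma nn_integral_lborel_scaleR:
  fixes f :: "'a::euclidean_space \<Rightarrow> ennreal"
  assumes [measurable]: "f \<in> borel_measurable borel" and c: "c > 0"
  shows "(\<integral>\<^sup>+x. f (c *\<^sub>R x) \<partial>lborel) = ennreal ((1 / c) ^ DIM('a)) * (\<integral>\<^sup>+x. f x \<partial>lborel)"
proof -
  have "(\<integral>\<^sup>+x. f (c *\<^sub>R x) \<partial>lborel) =
      (\<integral>\<^sup>+x. f (c *\<^sub>R x) \<partial>density (distr lborel borel (\<lambda>x::'a. 0 + (1/c) *\<^sub>R x)) (\<lambda>_. \<bar>1/c\<bar>^DIM('a)))"
    using c by (subst lborel_affine[of "1/c" 0]) auto
  also have "\<dots> = ennreal ((1 / c) ^ DIM('a)) * (\<integral>\<^sup>+x. f x \<partial>lborel)"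
    using c by (simp add: nn_integral_density nn_integral_distr nn_integral_cmult)
  finally show ?thesis .
qed

lemma nn_integral_radial_finite:
  fixes g :: "'a::euclidean_space \<Rightarrow> real" and s K :: real
  assumes s: "s > real DIM('a)" and K: "K \<ge> 0" and le1: "\<And>y. g y \<le> 1"
    and le2: "\<And>y. y \<noteq> 0 \<Longrightarrow> g y \<le> K * norm y powr (- s)"
  shows "(\<integral>\<^sup>+y. ennreal (g y) \<partial>lborel) < \<infinity>"
proof -
  define L where "L = max 1 (K * 2 powr s)"
  have L: "L \<ge> 1" "L \<ge> K * 2 powr s" by (auto simp: L_def)
  define h where "h n y = ennreal (L * 2 powr (- s * real n)) * indicator (ball 0 (2 ^ n)) y"
    for n and y :: 'a
  have "ennreal (g y) \<le> (\<Sum>n. h n y)" for y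
  proof -
    define n where "n = (LEAST n. norm y < 2 ^ n)"
    have ex: "\<exists>n. norm y < 2 ^ n" using real_arch_pow[of 2 "norm y"] by simp
    have n: "norm y < 2 ^ n" unfolding n_def using LeastI_ex[OF ex] .
    have "g y \<le> L * 2 powr (- s * real n)"
    proof (cases n)
      case 0
      then show ?thesis using le1[of y] L by simp
    next
      case (Suc m)
      have "\<not> norm y < 2 ^ m" using Suc unfolding n_def by (intro not_less_Least) simp
      then have ge: "2 powr real m \<le> norm y" by (simp add: powr_realpow)
      moreover have "(0::real) < 2 powr real m" by simp
      ultimately have y0: "y \<noteq> 0" by (metis norm_zero not_le)
      have "norm y powr (- s) \<le> (2 powr real m) powr (- s)"
        using ge s by (intro powr_mono2') auto
      also have "\<dots> = 2 powr s * 2 powr (- s * real n)"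
        unfolding powr_powr powr_add[symmetric] by (simp add: Suc algebra_simps)
      finally have "K * norm y powr (- s) \<le> (K * 2 powr s) * 2 powr (- s * real n)"
        using mult_left_mono[OF _ K] by (simp add: mult.assoc)
      also have "\<dots> \<le> L * 2 powr (- s * real n)" using L by (intro mult_right_mono) auto
      finally show ?thesis using le2[OF y0] by linarith
    qed
    then have "ennreal (g y) \<le> h n y" using n by (simp add: h_def ennreal_leI)
    also have "\<dots> \<le> (\<Sum>n. h n y)"
      using sum_le_suminf[of "\<lambda>n. h n y" "{n}"] by simp
    finally show ?thesis .
  qed
  then have le: "(\<integral>\<^sup>+y. ennreal (g y) \<partial>lborel) \<le> (\<integral>\<^sup>+y. (\<Sum>n. h n y) \<partial>lborel)"
    by (rule nn_integral_mono)
  have hm: "h n \<in> borel_measurable lborel" for n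
    unfolding h_def
    by (intro borel_measurable_times_ennreal borel_measurable_const borel_measurable_indicator)
       (simp only: sets_lborel borel_open open_ball)
  note le
  also have "(\<integral>\<^sup>+y. (\<Sum>n. h n y) \<partial>lborel) = (\<Sum>n. \<integral>\<^sup>+y. h n y \<partial>lborel)"
    by (rule nn_integral_suminf) (rule hm)
  also have "\<dots> = (\<Sum>n. ennreal (L * unit_ball_vol (real DIM('a)) * (2 powr (real DIM('a) - s)) ^ n))"
  proof (intro suminf_cong)
    fix n
    have "(2::real) powr (- s * real n) * (2 ^ n) ^ DIM('a) =
        2 powr (- s * real n) * 2 powr (real n * real DIM('a))"
    proof -
      have "(2 ^ n) ^ DIM('a) = (2::real) powr real (n * DIM('a))"
        by (subst powr_realpow) (simp_all only: power_mult zero_less_numeral)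
      then show ?thesis by (simp only: of_nat_mult)
    qed
    also have "\<dots> = 2 powr (real DIM('a) * real n - s * real n)"
      unfolding powr_add[symmetric] by (simp add: mult.commute)
    also have "\<dots> = (2 powr (real DIM('a) - s)) ^ n"
      by (simp add: powr_power algebra_simps)
    finally have eq: "(2::real) powr (- s * real n) * (2 ^ n) ^ DIM('a) =
        (2 powr (real DIM('a) - s)) ^ n" .
    have "(\<integral>\<^sup>+y. h n y \<partial>lborel) =
        ennreal (L * 2 powr (- s * real n)) * emeasure lborel (ball (0 :: 'a) (2 ^ n))"
      unfolding h_def by (rule nn_integral_cmult_indicator) (simp only: sets_lborel borel_open open_ball)
    also have "\<dots> = ennreal (L * 2 powr (- s * real n)) *
        ennreal (unit_ball_vol (real DIM('a)) * (2 ^ n) ^ DIM('a))"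
      by (subst emeasure_ball) auto
    also have "\<dots> = ennreal (L * unit_ball_vol (real DIM('a)) *
        (2 powr (- s * real n) * (2 ^ n) ^ DIM('a)))"
      using L by (subst ennreal_mult[symmetric]) (auto simp: mult_ac)
    finally show "(\<integral>\<^sup>+y. h n y \<partial>lborel) =
        ennreal (L * unit_ball_vol (real DIM('a)) * (2 powr (real DIM('a) - s)) ^ n)"
      unfolding eq .
  qed
  also have "\<dots> < \<infinity>"
  proof -
    have "2 powr (real DIM('a) - s) < 2 powr 0" using s by (intro powr_less_mono) auto
    then have "summable (\<lambda>n. L * unit_ball_vol (real DIM('a)) * (2 powr (real DIM('a) - s)) ^ n)"
      by (intro summable_mult summable_geometric) simp
    then show ?thesis using L by (subst suminf_ennreal2) auto
  qed
  finally show ?thesis .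
qed

lemma barenblatt_profile_measurable [measurable]:
  "(\<lambda>y :: real ^ 'n. barenblatt_profile p C y) \<in> borel_measurable borel"
  unfolding barenblatt_profile_def by measurable

lemma barenblatt_denom_pos:
  assumes "p_crit N < p"
  shows "0 < p + real N * (p - 2)"
  using assms by (simp add: p_crit_def field_simps)

lemma barenblatt_profile_nn_integral:
  assumes p: "p_crit CARD('n) < p" "p < 2" and N: "CARD('n) \<ge> 2"
  obtains I \<theta> where "I > 0" "\<theta> > 0"
    "\<And>C. C > 0 \<Longrightarrow>
       (\<integral>\<^sup>+y. ennreal (barenblatt_profile p C (y :: real ^ 'n)) \<partial>lborel) = ennreal (I * C powr (- \<theta>))"
proof -
  let ?N = "CARD('n)"
  define k where "k = (2 - p) / p * barenblatt_beta ?N p powr (1 / (p - 1))"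
  define q where "q = p / (p - 1)"
  define m where "m = (p - 1) / (2 - p)"
  have den: "0 < p + ?N * (p - 2)" by (rule barenblatt_denom_pos[OF p(1)])
  have "1 < p_crit ?N" using N by (simp add: p_crit_def field_simps)
  then have p1: "1 < p" using p by simp
  have k: "k > 0" unfolding k_def barenblatt_beta_def using den p p1 by simp
  have q: "q > 0" and m: "m > 0" unfolding q_def m_def using p p1 by auto
  have qm: "q * m = p / (2 - p)" unfolding q_def m_def using p1 by simp
  have qmN: "q * m > ?N" unfolding qm using den p by (simp add: field_simps)
  have prof: "barenblatt_profile p C y = (C + k * norm y powr q) powr (- m)" for C and y :: "real ^ 'n"
    by (simp add: barenblatt_profile_def k_def q_def m_def)
  define J where "J = (\<integral>\<^sup>+y. ennreal (barenblatt_profile p 1 (y :: real ^ 'n)) \<partial>lborel)"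
  have Jfin: "J < \<infinity>" unfolding J_def
  proof (rule nn_integral_radial_finite[where s = "q * m" and K = "k powr (- m)"])
    fix y :: "real ^ 'n"
    have "(1 + k * norm y powr q) powr (- m) \<le> 1 powr (- m)"
      using k m by (intro powr_mono2') auto
    then show "barenblatt_profile p 1 y \<le> 1" by (simp add: prof)
    assume "y \<noteq> 0"
    then have "(1 + k * norm y powr q) powr (- m) \<le> (k * norm y powr q) powr (- m)"
      using k m by (intro powr_mono2') auto
    also have "\<dots> = k powr (- m) * norm y powr (- (q * m))"
      using k by (simp add: powr_mult powr_powr)
    finally show "barenblatt_profile p 1 y \<le> k powr (- m) * norm y powr (- (q * m))"
      by (simp add: prof)
  qed (use qmN in auto)
  have pos: "barenblatt_profile p 1 y > 0" for y :: "real ^ 'n"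
  proof -
    have "1 + k * norm y powr q > 0" using k by (intro add_pos_nonneg) auto
    then show ?thesis by (simp add: prof)
  qed
  have "J \<noteq> 0"
  proof
    assume "J = 0"
    then have "AE y in lborel. ennreal (barenblatt_profile p 1 (y :: real ^ 'n)) = 0"
      unfolding J_def by (subst (asm) nn_integral_0_iff_AE) auto
    then have "AE y in (lborel :: (real ^ 'n) measure). False"
      by (rule AE_mp) (use pos in \<open>auto simp: ennreal_eq_0_iff not_le\<close>)
    then show False by (simp add: eventually_False ae_filter_eq_bot_iff)
  qed
  define I where "I = enn2real J"
  have I: "I > 0" "J = ennreal I"
    using Jfin \<open>J \<noteq> 0\<close> by (auto simp: I_def enn2real_positive_iff zero_less_iff_neq_zero)
  define \<theta> where "\<theta> = m - ?N / q"
  have \<theta>: "\<theta> > 0" unfolding \<theta>_def using qmN q by (simp add: field_simps)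
  have "(\<integral>\<^sup>+y. ennreal (barenblatt_profile p C (y :: real ^ 'n)) \<partial>lborel) = ennreal (I * C powr (- \<theta>))"
    if C: "C > 0" for C
  proof -
    define c where "c = C powr (- 1 / q)"
    have c: "c > 0" using C by (simp add: c_def)
    have scale: "barenblatt_profile p C y = C powr (- m) * barenblatt_profile p 1 (c *\<^sub>R y)"
      for y :: "real ^ 'n"
    proof -
      have "c powr q = inverse C" 
        unfolding c_def powr_powr using q C by (simp add: powr_minus)
      then have "C * (1 + k * norm (c *\<^sub>R y) powr q) = C + k * norm y powr q"
        using C c by (simp add: powr_mult field_simps)
      then have "(C + k * norm y powr q) powr (- m) =
          C powr (- m) * (1 + k * norm (c *\<^sub>R y) powr q) powr (- m)"
        using C k powr_mult[of C "1 + k * norm (c *\<^sub>R y) powr q" "- m"] by simp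
      then show ?thesis by (simp add: prof)
    qed
    have "(\<integral>\<^sup>+y. ennreal (barenblatt_profile p C (y :: real ^ 'n)) \<partial>lborel) =
        ennreal (C powr (- m)) * (\<integral>\<^sup>+y. ennreal (barenblatt_profile p 1 (c *\<^sub>R y :: real ^ 'n)) \<partial>lborel)"
      unfolding scale by (simp add: ennreal_mult' nn_integral_cmult)
    also have "\<dots> = ennreal (C powr (- m)) * (ennreal ((1 / c) ^ ?N) * ennreal I)"
      using nn_integral_lborel_scaleR[of "\<lambda>y :: real ^ 'n. ennreal (barenblatt_profile p 1 y)" c] c I
      by (simp add: J_def)
    also have "\<dots> = ennreal (C powr (- m) * ((1 / c) ^ ?N * I))"
      using I c by (simp add: ennreal_mult)
    also have "(1 / c) ^ ?N = C powr (?N / q)"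
    proof -
      have "1 / c = C powr (1 / q)" by (simp add: c_def powr_minus_divide)
      then show ?thesis using C by (simp add: powr_power)
    qed
    also have "C powr (- m) * (C powr (?N / q) * I) = I * C powr (- \<theta>)"
    proof -
      have "C powr (- \<theta>) = C powr (- m) * C powr (?N / q)"
        unfolding powr_add[symmetric] \<theta>_def by simp
      then show ?thesis by simp
    qed
    finally show ?thesis .
  qed
  with I(1) \<theta> that show ?thesis by blast
qed

lemma barenblatt_aux_nn_integral:
  assumes p: "p_crit CARD('n) < p" and t: "t > 0"
  shows "(\<integral>\<^sup>+x. ennreal (barenblatt_aux p C (x :: real ^ 'n) t) \<partial>lborel) =
    (\<integral>\<^sup>+y. ennreal (barenblatt_profile p C (y :: real ^ 'n)) \<partial>lborel)"
proof -
  let ?N = "CARD('n)" let ?c = "t powr (- barenblatt_beta ?N p)"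
  have c: "?c > 0" using t by simp
  have "(1 / ?c) ^ ?N = t powr barenblatt_alpha ?N p"
  proof -
    have "1 / ?c = t powr barenblatt_beta ?N p" using t by (simp add: powr_minus_divide)
    then show ?thesis
      using t by (simp add: powr_power barenblatt_alpha_def barenblatt_beta_def)
  qed
  then have one: "ennreal (t powr (- barenblatt_alpha ?N p)) * ennreal ((1 / ?c) ^ ?N) = 1"
    using t by (simp add: ennreal_mult[symmetric] powr_add[symmetric])
  have "(\<integral>\<^sup>+x. ennreal (barenblatt_aux p C (x :: real ^ 'n) t) \<partial>lborel) =
      ennreal (t powr (- barenblatt_alpha ?N p)) *
        (\<integral>\<^sup>+x. ennreal (barenblatt_profile p C (?c *\<^sub>R x :: real ^ 'n)) \<partial>lborel)"
    by (simp add: barenblatt_aux_def ennreal_mult' nn_integral_cmult)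
  also have "\<dots> = ennreal (t powr (- barenblatt_alpha ?N p)) * (ennreal ((1 / ?c) ^ ?N) *
        (\<integral>\<^sup>+y. ennreal (barenblatt_profile p C (y :: real ^ 'n)) \<partial>lborel))"
    using nn_integral_lborel_scaleR[of "\<lambda>y :: real ^ 'n. ennreal (barenblatt_profile p C y)" ?c] c
    by simp
  also have "\<dots> = (\<integral>\<^sup>+y. ennreal (barenblatt_profile p C (y :: real ^ 'n)) \<partial>lborel)"
    by (simp only: mult.assoc[symmetric] one mult_1_left)
  finally show ?thesis .
qed

lemma barenblatt_const_ex1:
  assumes p: "p_crit CARD('n) < p" "p < 2" and N: "CARD('n) \<ge> 2" and M: "M > 0"
  shows "\<exists>!C. 0 < C \<and>
    (\<forall>t>0. has_bochner_integral lborel (\<lambda>x :: real ^ 'n::finite. barenblatt_aux p C x t) M)"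
proof -
  obtain I \<theta> where I: "I > 0" "\<theta> > 0" "\<And>C. C > 0 \<Longrightarrow>
      (\<integral>\<^sup>+y. ennreal (barenblatt_profile p C (y :: real ^ 'n)) \<partial>lborel) = ennreal (I * C powr (- \<theta>))"
    using barenblatt_profile_nn_integral[OF p N] by metis
  have meas: "(\<lambda>x :: real ^ 'n. barenblatt_aux p C x t) \<in> borel_measurable lborel" for C t
    unfolding barenblatt_aux_def by measurable
  have nonneg: "barenblatt_aux p C x t \<ge> 0" for C t and x :: "real ^ 'n"
    by (simp add: barenblatt_aux_def barenblatt_profile_def)
  have iff: "has_bochner_integral lborel (\<lambda>x :: real ^ 'n. barenblatt_aux p C x t) M \<longleftrightarrow>
      I * C powr (- \<theta>) = M" if "C > 0" "t > 0" for C t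
  proof -
    have nn: "(\<integral>\<^sup>+x. ennreal (barenblatt_aux p C (x :: real ^ 'n) t) \<partial>lborel) = ennreal (I * C powr (- \<theta>))"
      using barenblatt_aux_nn_integral[OF p(1) that(2), of C] I(3)[OF that(1)] by simp
    have hbi: "has_bochner_integral lborel (\<lambda>x :: real ^ 'n. barenblatt_aux p C x t) (I * C powr (- \<theta>))"
      using I(1) by (intro has_bochner_integral_nn_integral meas nn AE_I2 nonneg) auto
    show ?thesis using has_bochner_integral_eq[OF hbi] hbi by metis
  qed
  have sol: "I * C powr (- \<theta>) = M \<longleftrightarrow> C = (M / I) powr (- 1 / \<theta>)" if "C > 0" for C
  proof
    assume "I * C powr (- \<theta>) = M"
    then have "M / I = C powr (- \<theta>)" using I by (simp add: field_simps)
    then show "C = (M / I) powr (- 1 / \<theta>)" using I that by (simp add: powr_powr)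
  next
    assume "C = (M / I) powr (- 1 / \<theta>)"
    then show "I * C powr (- \<theta>) = M" using I M by (simp add: powr_powr)
  qed
  show ?thesis
  proof (rule ex1I[where a = "(M / I) powr (- 1 / \<theta>)"])
    show "0 < (M / I) powr (- 1 / \<theta>) \<and> (\<forall>t>0. has_bochner_integral lborel
        (\<lambda>x :: real ^ 'n. barenblatt_aux p ((M / I) powr (- 1 / \<theta>)) x t) M)"
      using iff sol I M by auto
  next
    fix C assume "0 < C \<and> (\<forall>t>0. has_bochner_integral lborel (\<lambda>x :: real ^ 'n. barenblatt_aux p C x t) M)"
    then show "C = (M / I) powr (- 1 / \<theta>)"
      using iff[of C 1] sol[of C] by auto
  qed
qed

end

theory Submission
  imports Defs
begin

text \<open>
  Write \<open>N\<close> for the dimension, \<open>\<epsilon> = p - p\<^sub>c\<close> and \<open>s = p / (2 - p)\<close>.  The constant \<open>C\<^sub>p\<close> fixed by the mass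
  is positive and is raised to a negative power together with the radial term, so replacing it by 0
  enlarges the profile.  What is left is a pure power, the singular solution
  \<open>K(p) (\<epsilon> t |x| powr (- p)) powr (1 / (2 - p))\<close> with a factor \<open>K(p)\<close> that is continuous at \<open>p\<^sub>c\<close>
  (lemmas \<open>barenblatt_aux_le\<close> and \<open>tendsto_barenblatt_factor\<close>).  The small factor
  comes from \<open>1 / \<beta> = p + N (p - 2) = (N + 1) \<epsilon>\<close>.  This is the uniform
  estimate, and uniform convergence to zero away from the origin follows at once.

  For the convergence to the Dirac mass, the total mass is \<open>M\<close> for every \<open>p\<close>, so it suffices that
  the mass outside each ball tends to zero (lemma \<open>measures_tendsto_dirac\<close>).  The pointwise decay
  alone does not give this, because \<open>s\<close> tends to the critical exponent \<open>N\<close> and the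
  integral of \<open>|x| powr (- s)\<close> outside a ball blows up like \<open>1 / (s - N)\<close>, that is, like \<open>1 / \<epsilon>\<close>
  (lemma \<open>norm_powr_tail\<close>).  But the
  pointwise bound carries \<open>\<epsilon> powr (1 / (2 - p))\<close>, whose exponent tends to \<open>(N + 1) / 2 > 1\<close>, and
  so it wins: the exterior mass is at most of order \<open>\<epsilon> powr ((p - 1) / (2 - p))\<close>, with exponent tending to
  \<open>(N - 1) / 2 > 0\<close>.  The assumption \<open>N \<ge> 2\<close> enters as \<open>p\<^sub>c > 1\<close>.
\<close>

section \<open>Concentration of densities at the origin\<close>

lemma scale_measure_eq_density_const: "scale_measure r M = density M (\<lambda>_. r)"
  by (rule measure_eqI) (simp_all add: emeasure_density_const)

lemma integral_scale_measure:
  fixes f :: "'a \<Rightarrow> real"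
  assumes f: "f \<in> borel_measurable M" and r: "0 \<le> r"
  shows "(\<integral>x. f x \<partial>scale_measure (ennreal r) M) = r * (\<integral>x. f x \<partial>M)"
  unfolding scale_measure_eq_density_const using f r by (subst integral_density) auto

text \<open>
  Compare \<open>f\<close> with \<open>f 0\<close>: near the origin they differ by little, and elsewhere by at most
  the oscillation of \<open>f\<close>, which is multiplied by a vanishing mass.
\<close>
lemma measures_tendsto_dirac:
  fixes u :: "'i \<Rightarrow> 'a::euclidean_space \<Rightarrow> real"
  assumes M: "0 \<le> M"
    and mass: "\<forall>\<^sub>F i in F. has_bochner_integral lborel (u i) M"
    and nonneg: "\<forall>\<^sub>F i in F. \<forall>x. 0 \<le> u i x"
    and tail: "\<And>r. 0 < r \<Longrightarrow>
      ((\<lambda>i. \<integral>x. indicator {x. r \<le> norm x} x * u i x \<partial>lborel) \<longlongrightarrow> 0) F"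
  shows "measures_tendsto (\<lambda>i. density lborel (\<lambda>x. ennreal (u i x)))
           (scale_measure (ennreal M) (return borel 0)) F"
  unfolding measures_tendsto_def
proof (intro allI impI)
  fix f :: "'a \<Rightarrow> real"
  assume cont: "continuous_on UNIV f" and "bounded (range f)"
  then obtain B where B: "\<And>x. \<bar>f x\<bar> \<le> B" by (auto simp: bounded_iff)
  have f[measurable]: "f \<in> borel_measurable borel"
    using cont by (rule borel_measurable_continuous_onI)
  have lim: "(\<integral>x. f x \<partial>scale_measure (ennreal M) (return borel 0)) = M * f 0"
    using M by (simp add: integral_scale_measure integral_return)
  show "((\<lambda>i. \<integral>x. f x \<partial>density lborel (\<lambda>x. ennreal (u i x))) \<longlongrightarrow>
      (\<integral>x. f x \<partial>scale_measure (ennreal M) (return borel 0))) F"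
    unfolding lim
  proof (rule tendstoI)
    fix e :: real assume e: "0 < e"
    define d where "d = e / (2 * (M + 1))"
    have d: "0 < d" "d * M < e / 2"
      using e M by (auto simp: d_def field_simps)
    have "isCont f 0" using cont by (simp add: continuous_on_eq_continuous_at)
    then obtain r where r: "0 < r" "\<And>x. norm x < r \<Longrightarrow> \<bar>f x - f 0\<bar> < d"
      using d(1) unfolding continuous_at_eps_delta dist_norm by (metis diff_zero real_norm_def)
    let ?A = "{x::'a. r \<le> norm x}"
    have A: "?A \<in> sets borel" by measurable
    have "((\<lambda>i. 2 * B * (\<integral>x. indicator ?A x * u i x \<partial>lborel)) \<longlongrightarrow> 2 * B * 0) F"
      by (intro tendsto_intros tail r)
    then have "\<forall>\<^sub>F i in F. 2 * B * (\<integral>x. indicator ?A x * u i x \<partial>lborel) < e / 2"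
      by (rule order_tendstoD) (use e in simp)
    with mass nonneg
    show "\<forall>\<^sub>F i in F. dist (\<integral>x. f x \<partial>density lborel (\<lambda>x. ennreal (u i x))) (M * f 0) < e"
    proof eventually_elim
      case (elim i)
      have int: "integrable lborel (u i)" and M_eq: "(\<integral>x. u i x \<partial>lborel) = M"
        using elim(1) by (auto simp: has_bochner_integral_iff)
      have [measurable]: "u i \<in> borel_measurable borel"
        using borel_measurable_integrable[OF int] by simp
      have u0: "0 \<le> u i x" for x using elim(2) by blast
      have intA: "integrable lborel (\<lambda>x. indicator ?A x * u i x)"
        using integrable_mult_indicator[OF _ int, of ?A] A by simp
      have intf: "integrable lborel (\<lambda>x. u i x * f x)"
      proof (rule Bochner_Integration.integrable_bound)
        show "integrable lborel (\<lambda>x. B * u i x)" using int by simp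
        show "AE x in lborel. norm (u i x * f x) \<le> norm (B * u i x)"
        proof (rule AE_I2)
          fix x
          have "\<bar>f x\<bar> * \<bar>u i x\<bar> \<le> \<bar>B\<bar> * \<bar>u i x\<bar>" using B[of x] by (intro mult_right_mono) auto
          then show "norm (u i x * f x) \<le> norm (B * u i x)" by (simp add: abs_mult mult.commute)
        qed
      qed simp
      have "(\<integral>x. f x \<partial>density lborel (\<lambda>x. ennreal (u i x))) = (\<integral>x. u i x * f x \<partial>lborel)"
        using u0 by (subst integral_density) auto
      moreover have "M * f 0 = (\<integral>x. u i x * f 0 \<partial>lborel)" by (simp add: M_eq)
      ultimately have "dist (\<integral>x. f x \<partial>density lborel (\<lambda>x. ennreal (u i x))) (M * f 0)
          = \<bar>\<integral>x. u i x * f x - u i x * f 0 \<partial>lborel\<bar>"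
        using int intf by (simp add: dist_real_def Bochner_Integration.integral_diff M_eq)
      also have "\<dots> \<le> (\<integral>x. \<bar>u i x * f x - u i x * f 0\<bar> \<partial>lborel)"
        by (rule integral_abs_bound)
      also have "\<dots> \<le> (\<integral>x. d * u i x + 2 * B * (indicator ?A x * u i x) \<partial>lborel)"
      proof (rule integral_mono)
        fix x
        have "\<bar>f x - f 0\<bar> \<le> d + 2 * B * indicator ?A x"
          using r(2)[of x] B[of x] B[of 0] d(1) by (cases "r \<le> norm x") auto
        then have "u i x * \<bar>f x - f 0\<bar> \<le> u i x * (d + 2 * B * indicator ?A x)"
          by (intro mult_left_mono u0)
        then show "\<bar>u i x * f x - u i x * f 0\<bar> \<le> d * u i x + 2 * B * (indicator ?A x * u i x)"
          using u0[of x] unfolding right_diff_distrib[symmetric] abs_mult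
          by (simp add: algebra_simps)
      qed (use int intf intA in auto)
      also have "\<dots> = d * M + 2 * B * (\<integral>x. indicator ?A x * u i x \<partial>lborel)"
        using int intA by (simp add: M_eq)
      also have "\<dots> < e" using d(2) elim(3) by linarith
      finally show ?case .
    qed
  qed
qed

section \<open>Integrals of supercritical powers outside a ball\<close>

text \<open>
  Doubling the radius multiplies the integral \<open>A\<close> by \<open>2 powr (DIM - s)\<close>, so
  \<open>(1 - 2 powr (DIM - s)) A\<close> is the integral over the shell between \<open>r\<close> and \<open>2 r\<close>, at most the
  volume of a ball.  The rate \<open>1 / (s - DIM)\<close> of the blow-up at the critical exponent
  is what the application depends on.
\<close>
lemma norm_powr_tail:
  fixes s r :: real
  assumes s: "real DIM('a::euclidean_space) < s" and r: "0 < r"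
  defines "g \<equiv> (\<lambda>y::'a. indicator {y. r \<le> norm y} y * norm y powr (- s))"
  shows "integrable lborel g"
    and "(\<integral>y. g y \<partial>lborel) \<le> r powr (- s) *
           (unit_ball_vol (real DIM('a)) * (2 * r) ^ DIM('a) * (1 + 2 / (s - real DIM('a))))"
proof -
  \<comment> \<open>With this normalisation the integrand is at most 1, and the shell integral at most a volume.\<close>
  define h where "h = (\<lambda>y::'a. indicator {y. r \<le> norm y} y * (norm y / r) powr (- s))"
  have s0: "0 < s" using s by (meson le_less_trans of_nat_0_le_iff)
  have [measurable]: "h \<in> borel_measurable borel" unfolding h_def by measurable
  have h0: "0 \<le> h y" for y by (simp add: h_def)
  have gh: "g = (\<lambda>y. r powr (- s) * h y)"
    using r by (auto simp: g_def h_def fun_eq_iff powr_divide)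
  have h1: "h y \<le> 1" for y
  proof (cases "r \<le> norm y")
    case True
    then have "(norm y / r) powr (- s) \<le> 1 powr (- s)"
      using r s0 by (intro powr_mono2') (auto simp: field_simps)
    then show ?thesis by (simp add: h_def True)
  qed (simp add: h_def)
  define I where "I = (\<integral>\<^sup>+y. ennreal (h y) \<partial>lborel)"
  have Ifin: "I < \<infinity>" unfolding I_def
  proof (rule nn_integral_radial_finite[OF s])
    show "0 \<le> r powr s" by simp
    show "h y \<le> r powr s * norm y powr (- s)" for y
      using r by (auto simp: h_def powr_divide powr_minus field_simps split: split_indicator)
  qed (rule h1)
  define a where "a = enn2real I"
  have a: "I = ennreal a" "0 \<le> a" using Ifin by (auto simp: a_def)
  define q where "q = 2 powr (real DIM('a) - s)"
  define V where "V = unit_ball_vol (real DIM('a)) * (2 * r) ^ DIM('a)"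
  have V: "0 \<le> V" using r by (simp add: V_def)
  have dec: "h y \<le> indicator (ball 0 (2 * r)) y + 2 powr (- s) * h ((1/2) *\<^sub>R y)" for y
  proof (cases "norm y < 2 * r")
    case True
    then show ?thesis using h1[of y] h0[of "(1/2) *\<^sub>R y"] by (simp add: add.commute add_increasing2)
  next
    case False
    have "norm y / r = 2 * (norm ((1/2) *\<^sub>R y) / r)" by simp
    then have "(norm y / r) powr (- s) = 2 powr (- s) * (norm ((1/2) *\<^sub>R y) / r) powr (- s)"
      by (simp only: powr_mult)
    then show ?thesis using False r by (simp add: h_def)
  qed
  have "I \<le> (\<integral>\<^sup>+y. indicator (ball 0 (2 * r)) y + ennreal (2 powr (- s)) * ennreal (h ((1/2) *\<^sub>R y)) \<partial>lborel)"
    unfolding I_def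
  proof (rule nn_integral_mono)
    fix y
    have "ennreal (h y) \<le> ennreal (indicator (ball 0 (2 * r)) y + 2 powr (- s) * h ((1/2) *\<^sub>R y))"
      by (intro ennreal_leI dec)
    then show "ennreal (h y) \<le> indicator (ball 0 (2 * r)) y + ennreal (2 powr (- s)) * ennreal (h ((1/2) *\<^sub>R y))"
      by (simp add: ennreal_plus h0 ennreal_mult ennreal_indicator)
  qed
  also have "\<dots> = emeasure lborel (ball (0::'a) (2 * r)) +
      ennreal (2 powr (- s)) * (\<integral>\<^sup>+y. ennreal (h ((1/2) *\<^sub>R y)) \<partial>lborel)"
  proof -
    have [measurable]: "(\<lambda>y. h ((1/2) *\<^sub>R y)) \<in> borel_measurable borel" by measurable
    have "(\<lambda>y. indicator (ball (0::'a) (2 * r)) y :: ennreal) \<in> borel_measurable borel"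
      by (intro borel_measurable_indicator) simp
    then show ?thesis by (subst nn_integral_add) (simp_all add: nn_integral_cmult)
  qed
  also have "(\<integral>\<^sup>+y. ennreal (h ((1/2) *\<^sub>R y)) \<partial>lborel) = ennreal (2 ^ DIM('a)) * I"
    using nn_integral_lborel_scaleR[of "\<lambda>y. ennreal (h y)" "1/2"] by (simp add: I_def)
  also have "emeasure lborel (ball (0::'a) (2 * r)) = ennreal V"
    using r by (simp add: V_def emeasure_ball)
  also have "ennreal V + ennreal (2 powr (- s)) * (ennreal (2 ^ DIM('a)) * I) = ennreal (V + q * a)"
  proof -
    have "2 powr (- s) * 2 ^ DIM('a) = q"
      unfolding q_def by (simp add: powr_diff powr_realpow powr_minus_divide)
    moreover have "0 \<le> q * a" using a by (simp add: q_def)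
    ultimately show ?thesis
      using a V by (simp add: ennreal_mult[symmetric] ennreal_plus[symmetric] mult.assoc[symmetric] del: ennreal_plus)
  qed
  finally have rec: "a \<le> V + q * a"
    using a V by (simp add: ennreal_le_iff q_def del: ennreal_plus)
  \<comment> \<open>The convexity bound \<open>exp x \<ge> 1 + x\<close>, with \<open>ln 2 \<ge> 1/2\<close>.\<close>
  define \<delta> where "\<delta> = s - real DIM('a)"
  have \<delta>: "0 < \<delta>" using s by (simp add: \<delta>_def)
  have "1 + \<delta> / 2 \<le> 1 + \<delta> * ln 2" using ln2_ge_two_thirds \<delta> by simp
  also have "\<dots> \<le> exp (\<delta> * ln 2)" by (rule exp_ge_add_one_self)
  finally have "1 + \<delta> / 2 \<le> 1 / q"
    by (simp add: q_def \<delta>_def powr_def exp_minus[symmetric] inverse_eq_divide[symmetric] algebra_simps)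
  moreover have q: "0 < q" by (simp add: q_def)
  ultimately have "q * (1 + \<delta> / 2) \<le> 1" by (simp add: field_simps)
  then have "(q * a) * (1 + \<delta> / 2) \<le> a" using a(2) mult_left_mono[of "q * (1 + \<delta> / 2)" 1 a] by (simp add: mult_ac)
  moreover have "a * (1 + \<delta> / 2) \<le> (V + q * a) * (1 + \<delta> / 2)" using rec \<delta> by (intro mult_right_mono) auto
  ultimately have "a * (\<delta> / 2) \<le> V * (1 + \<delta> / 2)"
    using distrib_right[of V "q * a" "1 + \<delta> / 2"] distrib_left[of a 1 "\<delta> / 2"] by linarith
  then have le: "a \<le> V * (1 + 2 / \<delta>)" using \<delta> by (simp add: field_simps)
  have hbi: "has_bochner_integral lborel h a"
    using a by (intro has_bochner_integral_nn_integral) (auto simp: I_def h0)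
  then show "integrable lborel g" unfolding gh by (simp add: has_bochner_integral_iff)
  have "(\<integral>y. g y \<partial>lborel) = r powr (- s) * a"
    using hbi unfolding gh by (simp add: has_bochner_integral_iff)
  also have "\<dots> \<le> r powr (- s) * (V * (1 + 2 / \<delta>))" using le by (intro mult_left_mono) auto
  finally show "(\<integral>y. g y \<partial>lborel) \<le> r powr (- s) *
           (unit_ball_vol (real DIM('a)) * (2 * r) ^ DIM('a) * (1 + 2 / (s - real DIM('a))))"
    by (simp add: V_def \<delta>_def)
qed

section \<open>The pointwise bound by the singular solution\<close>

text \<open>
  The coefficient of the singular solution, the limit of the fundamental solutions as \<open>C\<close> tends
  to 0, with the power of \<open>p - p\<^sub>c\<close> split off so that it stays bounded near \<open>p\<^sub>c\<close>.
\<close>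
definition barenblatt_factor :: "nat \<Rightarrow> real \<Rightarrow> real" where
  "barenblatt_factor N p =
     (p / (2 - p)) powr ((p - 1) / (2 - p)) * (real N + 1) powr (1 / (2 - p))"

lemma p_crit_bounds:
  assumes "2 \<le> N" shows "1 < p_crit N" "p_crit N < 2"
  using assms by (simp_all add: p_crit_def field_simps)

lemma eventually_near_p_crit:
  assumes "2 \<le> N"
  shows "\<forall>\<^sub>F p in at_right (p_crit N). p_crit N < p \<and> p < 2"
  using eventually_at_right_less[of "p_crit N"] eventually_at_right_field p_crit_bounds(2)[OF assms]
  by (metis (mono_tags, lifting))

lemma tendsto_barenblatt_factor:
  assumes "2 \<le> N"
  shows "(barenblatt_factor N \<longlongrightarrow> barenblatt_factor N (p_crit N)) (at_right (p_crit N))"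
  unfolding barenblatt_factor_def using p_crit_bounds[OF assms] by (intro tendsto_intros) auto

lemma barenblatt_denom_eq: "p + real N * (p - 2) = (real N + 1) * (p - p_crit N)"
  by (simp add: p_crit_def field_simps)

text \<open>
  Replacing \<open>C\<close> by 0 enlarges the profile and turns it into a pure power.  In the self-similar scaling the powers of \<open>t\<close>
  combine because \<open>\<beta> p / (2 - p) - \<alpha> = 1 / (2 - p)\<close>.
\<close>
lemma barenblatt_aux_le:
  fixes x :: "real ^ 'n::finite"
  assumes p: "p_crit CARD('n) < p" "p < 2" and N: "CARD('n) \<ge> 2"
    and C: "0 < C" and t: "0 < t" and x: "x \<noteq> 0"
  shows "barenblatt_aux p C x t \<le> barenblatt_factor CARD('n) p *
           ((p - p_crit CARD('n)) * t * norm x powr (- p)) powr (1 / (2 - p))"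
proof -
  define n where "n = real CARD('n)"
  define \<epsilon> where "\<epsilon> = p - p_crit CARD('n)"
  define D where "D = (n + 1) * \<epsilon>"
  define m where "m = (p - 1) / (2 - p)"
  define w where "w = 1 / (2 - p)"
  have p1: "1 < p" using p p_crit_bounds(1)[OF N] by simp
  have \<epsilon>: "0 < \<epsilon>" and n: "0 \<le> n" and D: "0 < D" using p by (auto simp: \<epsilon>_def n_def D_def)
  have m: "0 < m" and w: "0 < w" using p p1 by (auto simp: m_def w_def)
  have D_eq: "p + n * (p - 2) = D" unfolding D_def \<epsilon>_def n_def by (rule barenblatt_denom_eq)
  have beta: "barenblatt_beta CARD('n) p = 1 / D" and alpha: "barenblatt_alpha CARD('n) p = n / D"
    unfolding barenblatt_beta_def barenblatt_alpha_def n_def[symmetric] D_eq by simp_all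
  define R where "R = t powr (- 1 / D) * norm x"
  have R: "0 < R" using t x by (simp add: R_def)
  define k where "k = (2 - p) / p * (1 / D) powr (1 / (p - 1))"
  have k: "0 < k" using p p1 D by (simp add: k_def)
  have "barenblatt_aux p C x t = t powr (- n / D) * (C + k * R powr (p / (p - 1))) powr (- m)"
    using t by (simp add: barenblatt_aux_def barenblatt_profile_def beta alpha k_def m_def R_def)
  also have "\<dots> \<le> t powr (- n / D) * (k * R powr (p / (p - 1))) powr (- m)"
    using C k R m by (intro mult_left_mono powr_mono2') auto
  also have "(k * R powr (p / (p - 1))) powr (- m) = k powr (- m) * R powr (- (p * w))"
  proof -
    have "p / (p - 1) * m = p * w" using p1 by (simp add: m_def w_def)
    then show ?thesis using k R by (simp add: powr_mult powr_powr)
  qed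
  also have "k powr (- m) = (p / (2 - p)) powr m * D powr w"
  proof -
    have "1 / (p - 1) * m = w" using p1 by (simp add: m_def w_def)
    moreover have "k powr (- m) = ((2 - p) / p) powr (- m) * (1 / D) powr (- (1 / (p - 1) * m))"
      using p p1 D unfolding k_def by (simp only: powr_mult powr_powr mult_minus_right)
    moreover have "((2 - p) / p) powr (- m) = (p / (2 - p)) powr m"
      using p p1 by (simp add: powr_divide powr_minus field_simps)
    moreover have "(1 / D) powr (- w) = D powr w"
      using D by (simp add: powr_divide powr_minus)
    ultimately show ?thesis by simp
  qed
  also have "D powr w = (n + 1) powr w * \<epsilon> powr w" using n \<epsilon> by (simp add: D_def powr_mult)
  also have "R powr (- (p * w)) = t powr (p * w / D) * norm x powr (- (p * w))"
    using t by (simp add: R_def powr_mult powr_powr)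
  finally have "barenblatt_aux p C x t \<le> (p / (2 - p)) powr m * (n + 1) powr w *
      (\<epsilon> powr w * (t powr (- n / D) * t powr (p * w / D)) * norm x powr (- (p * w)))"
    by (simp add: mult_ac)
  also have "t powr (- n / D) * t powr (p * w / D) = t powr w"
  proof -
    have "p - n * (2 - p) = D" using D_eq by (simp add: algebra_simps)
    moreover have "n = n * (2 - p) * w" using p by (simp add: w_def)
    ultimately have "p * w - n = D * w" by (metis left_diff_distrib)
    then have "- n / D + p * w / D = w" using D by (simp add: field_simps)
    then show ?thesis by (simp add: powr_add[symmetric])
  qed
  also have "\<epsilon> powr w * t powr w * norm x powr (- (p * w)) = (\<epsilon> * t * norm x powr (- p)) powr w"
    using \<epsilon> t by (simp add: powr_mult powr_powr)
  finally show ?thesis by (simp add: barenblatt_factor_def m_def w_def n_def \<epsilon>_def)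
qed

section \<open>The fundamental solution near the critical exponent\<close>

lemma barenblatt_const_props:
  assumes "p_crit CARD('n) < p" "p < 2" "CARD('n::finite) \<ge> 2" "M > 0"
  shows "0 < barenblatt_const TYPE('n) p M"
    and "t > 0 \<Longrightarrow> has_bochner_integral lborel (\<lambda>x::real^'n. barenblatt p x t M) M"
  using theI'[OF barenblatt_const_ex1[OF assms]] unfolding barenblatt_const_def[of "TYPE('n)" p M, symmetric]
  by (simp_all add: barenblatt_def)

lemma barenblatt_nonneg: "0 \<le> barenblatt p x t M"
  by (simp add: barenblatt_def barenblatt_aux_def barenblatt_profile_def)

lemma barenblatt_le:
  fixes x :: "real ^ 'n::finite"
  assumes "p_crit CARD('n) < p" "p < 2" "CARD('n) \<ge> 2" "M > 0" "0 < t" "x \<noteq> 0"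
  shows "barenblatt p x t M \<le> barenblatt_factor CARD('n) p *
           ((p - p_crit CARD('n)) * t * norm x powr (- p)) powr (1 / (2 - p))"
  unfolding barenblatt_def using assms by (intro barenblatt_aux_le barenblatt_const_props)

text \<open>
  The integral of the bound has the factor \<open>\<epsilon> powr (1 / (2 - p))\<close> and, from the integral of
  the power, \<open>1 + 2 / (s - N)\<close> with \<open>s - N = (N + 1) \<epsilon> / (2 - p)\<close>.  One factor \<open>\<epsilon>\<close> cancels,
  and a positive power of \<open>\<epsilon>\<close> remains because \<open>1 / (2 - p) - 1 = (p - 1) / (2 - p)\<close> and \<open>p > 1\<close>.
\<close>
lemma barenblatt_tail_le:
  fixes r t M :: real
  assumes p: "p_crit CARD('n::finite) < p" "p < 2" and N: "CARD('n) \<ge> 2"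
    and M: "M > 0" and t: "0 < t" and r: "0 < r"
  defines "n \<equiv> real CARD('n)" and "\<epsilon> \<equiv> p - p_crit CARD('n)"
  shows "(\<integral>x. indicator {x::real^'n. r \<le> norm x} x * barenblatt p x t M \<partial>lborel) \<le>
    barenblatt_factor CARD('n) p * t powr (1 / (2 - p)) * r powr (- (p / (2 - p))) *
    (unit_ball_vol n * (2 * r) ^ CARD('n)) *
    (\<epsilon> powr ((p - 1) / (2 - p)) * (\<epsilon> + 2 * (2 - p) / (n + 1)))"
proof -
  define w where "w = 1 / (2 - p)"
  define s where "s = p * w"
  define K where "K = barenblatt_factor CARD('n) p * (\<epsilon> * t) powr w"
  let ?A = "{x::real^'n. r \<le> norm x}"
  have \<epsilon>: "0 < \<epsilon>" and n: "0 \<le> n" using p by (auto simp: \<epsilon>_def n_def)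
  have sn: "s - n = (n + 1) * \<epsilon> / (2 - p)"
  proof -
    have "p + n * (p - 2) = (n + 1) * \<epsilon>" unfolding \<epsilon>_def n_def by (rule barenblatt_denom_eq)
    then show ?thesis using p by (simp add: s_def w_def field_simps)
  qed
  have "0 < s - n" unfolding sn using p \<epsilon> n by simp
  then have s: "real DIM(real^'n) < s" by (simp add: n_def)
  have K: "0 \<le> K" by (simp add: K_def barenblatt_factor_def)
  note tl = norm_powr_tail[where 'a = "real^'n", OF s r]
  have "(\<integral>x. indicator ?A x * barenblatt p x t M \<partial>lborel) \<le>
      (\<integral>x. K * (indicator ?A x * norm x powr (- s)) \<partial>lborel)"
  proof (rule integral_mono')
    show "integrable lborel (\<lambda>x. K * (indicator ?A x * norm x powr (- s)))"
      using tl(1) by simp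
    fix x :: "real^'n"
    show "indicator ?A x * barenblatt p x t M \<le> K * (indicator ?A x * norm x powr (- s))"
    proof (cases "r \<le> norm x")
      case True
      then have "x \<noteq> 0" using r by auto
      then have "barenblatt p x t M \<le>
          barenblatt_factor CARD('n) p * (\<epsilon> * t * norm x powr (- p)) powr w"
        unfolding \<epsilon>_def w_def by (intro barenblatt_le p N M t)
      also have "\<dots> = K * norm x powr (- s)"
        using \<epsilon> t by (simp add: K_def s_def powr_mult powr_powr)
      finally show ?thesis using True by simp
    qed simp
  qed (use K in auto)
  also have "\<dots> \<le> K * (r powr (- s) * (unit_ball_vol n * (2 * r) ^ CARD('n) * (1 + 2 / (s - n))))"
    using mult_left_mono[OF tl(2) K] by (simp add: n_def)
  also have "K = barenblatt_factor CARD('n) p * t powr w * (\<epsilon> powr ((p - 1) / (2 - p)) * \<epsilon>)"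
  proof -
    have w_eq: "w = (p - 1) / (2 - p) + 1" using p by (simp add: w_def field_simps)
    have "\<epsilon> powr w = \<epsilon> powr ((p - 1) / (2 - p)) * \<epsilon>"
      unfolding w_eq powr_add using \<epsilon> by simp
    then show ?thesis using \<epsilon> t by (simp add: K_def powr_mult)
  qed
  also have "1 + 2 / (s - n) = (\<epsilon> + 2 * (2 - p) / (n + 1)) / \<epsilon>"
  proof -
    have "2 / ((n + 1) * \<epsilon> / (2 - p)) = 2 * (2 - p) / (n + 1) / \<epsilon>" by simp
    then show ?thesis unfolding sn using \<epsilon> by (simp add: add_divide_distrib)
  qed
  finally show ?thesis using \<epsilon> by (simp add: s_def w_def mult_ac)
qed

lemma barenblatt_tail_tendsto_0:
  assumes N: "CARD('n::finite) \<ge> 2" and M: "M > 0" and t: "0 < t" and r: "0 < r"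
  shows "((\<lambda>p. \<integral>x. indicator {x::real^'n. r \<le> norm x} x * barenblatt p x t M \<partial>lborel) \<longlongrightarrow> 0)
           (at_right (p_crit CARD('n)))"
proof -
  let ?c = "p_crit CARD('n)" and ?n = "real CARD('n)"
  let ?b = "\<lambda>p. barenblatt_factor CARD('n) p * t powr (1 / (2 - p)) * r powr (- (p / (2 - p))) *
    (unit_ball_vol ?n * (2 * r) ^ CARD('n)) *
    ((p - ?c) powr ((p - 1) / (2 - p)) * ((p - ?c) + 2 * (2 - p) / (?n + 1)))"
  note c = p_crit_bounds[OF N]
  have upper: "\<forall>\<^sub>F p in at_right ?c.
      (\<integral>x. indicator {x::real^'n. r \<le> norm x} x * barenblatt p x t M \<partial>lborel) \<le> ?b p"
    using eventually_near_p_crit[OF N] by eventually_elim (intro barenblatt_tail_le N M t r; simp)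
  have lim: "((\<lambda>p. p - ?c) \<longlongrightarrow> 0) (at_right ?c)"
    using tendsto_diff[OF tendsto_ident_at[of ?c "{?c<..}"] tendsto_const[of ?c]] by simp
  have "((\<lambda>p. (p - ?c) powr ((p - 1) / (2 - p))) \<longlongrightarrow> 0) (at_right ?c)"
  proof (rule tendsto_zero_powrI[OF lim])
    show "((\<lambda>p. (p - 1) / (2 - p)) \<longlongrightarrow> (?c - 1) / (2 - ?c)) (at_right ?c)"
      using c by (intro tendsto_intros) auto
    show "\<forall>\<^sub>F p in at_right ?c. 0 \<le> p - ?c"
      using eventually_near_p_crit[OF N] by eventually_elim simp
  qed (use c in simp)
  then have "(?b \<longlongrightarrow> barenblatt_factor CARD('n) ?c * t powr (1 / (2 - ?c)) * r powr (- (?c / (2 - ?c))) *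
      (unit_ball_vol ?n * (2 * r) ^ CARD('n)) * (0 * (0 + 2 * (2 - ?c) / (?n + 1)))) (at_right ?c)"
    using c t r
    by (intro tendsto_mult tendsto_add tendsto_barenblatt_factor[OF N] lim tendsto_powr
        tendsto_divide tendsto_minus tendsto_diff tendsto_const tendsto_ident_at) auto
  then have b: "(?b \<longlongrightarrow> 0) (at_right ?c)" by simp
  show ?thesis
  proof (rule tendsto_sandwich[OF _ upper tendsto_const b])
    show "\<forall>\<^sub>F p in at_right ?c.
        0 \<le> (\<integral>x. indicator {x::real^'n. r \<le> norm x} x * barenblatt p x t M \<partial>lborel)"
      by (intro always_eventually allI Bochner_Integration.integral_nonneg mult_nonneg_nonneg
          barenblatt_nonneg) simp
  qed
qed

lemma uniform_limit_barenblatt: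
  assumes N: "CARD('n::finite) \<ge> 2" and M: "M > 0" and t: "0 < t" and r: "0 < r"
  shows "uniform_limit {x :: real ^ 'n. norm x \<ge> r}
            (\<lambda>p x. barenblatt p x t M) (\<lambda>x. 0) (at_right (p_crit CARD('n)))"
proof (rule uniform_limitI)
  let ?c = "p_crit CARD('n)"
  let ?b = "\<lambda>p. barenblatt_factor CARD('n) p * ((p - ?c) * t * r powr (- p)) powr (1 / (2 - p))"
  note c = p_crit_bounds[OF N]
  fix e :: real assume e: "0 < e"
  have lim: "((\<lambda>p. p - ?c) \<longlongrightarrow> 0) (at_right ?c)"
    using tendsto_diff[OF tendsto_ident_at[of ?c "{?c<..}"] tendsto_const[of ?c]] by simp
  have "((\<lambda>p. ((p - ?c) * t * r powr (- p)) powr (1 / (2 - p))) \<longlongrightarrow> 0) (at_right ?c)"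
  proof (rule tendsto_zero_powrI)
    have "((\<lambda>p. (p - ?c) * t * r powr (- p)) \<longlongrightarrow> 0 * t * r powr (- ?c)) (at_right ?c)"
      using r by (intro tendsto_mult lim tendsto_powr tendsto_const tendsto_minus tendsto_ident_at) simp
    then show "((\<lambda>p. (p - ?c) * t * r powr (- p)) \<longlongrightarrow> 0) (at_right ?c)" by simp
    show "((\<lambda>p. 1 / (2 - p)) \<longlongrightarrow> 1 / (2 - ?c)) (at_right ?c)"
      using c by (intro tendsto_intros) auto
    show "\<forall>\<^sub>F p in at_right ?c. 0 \<le> (p - ?c) * t * r powr (- p)"
      using eventually_near_p_crit[OF N] by eventually_elim (use t in simp)
  qed (use c in simp)
  then have "(?b \<longlongrightarrow> barenblatt_factor CARD('n) ?c * 0) (at_right ?c)"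
    by (intro tendsto_mult tendsto_barenblatt_factor[OF N])
  then have "\<forall>\<^sub>F p in at_right ?c. ?b p < e"
    by (rule order_tendstoD) (use e in simp)
  with eventually_near_p_crit[OF N]
  show "\<forall>\<^sub>F p in at_right ?c. \<forall>x\<in>{x::real^'n. r \<le> norm x}. dist (barenblatt p x t M) 0 < e"
  proof eventually_elim
    case (elim p)
    show ?case
    proof
      fix x :: "real^'n" assume "x \<in> {x. r \<le> norm x}"
      then have x: "r \<le> norm x" "x \<noteq> 0" using r by auto
      have "barenblatt p x t M \<le> barenblatt_factor CARD('n) p *
          ((p - ?c) * t * norm x powr (- p)) powr (1 / (2 - p))"
        using elim by (intro barenblatt_le N M t x) auto
      also have "\<dots> \<le> ?b p"
        using elim x r t c
        by (intro mult_left_mono powr_mono2 powr_mono2') (auto simp: barenblatt_factor_def)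
      finally show "dist (barenblatt p x t M) 0 < e"
        using elim barenblatt_nonneg[of p x t M] by (simp add: dist_real_def)
    qed
  qed
qed

theorem theorem8p3:
  fixes M :: real
  assumes N: "CARD('n::finite) \<ge> 2"
    and M: "M > 0"
  shows "(\<forall>t>0. measures_tendsto
            (\<lambda>p. density lborel (\<lambda>x :: real ^ 'n. ennreal (barenblatt p x t M)))
            (scale_measure (ennreal M) (return borel 0))
            (at_right (p_crit CARD('n))))
    \<and> (\<exists>C>0. \<exists>\<epsilon>\<^sub>0>0. p_crit CARD('n) + \<epsilon>\<^sub>0 \<le> 2 \<and>
          (\<forall>\<epsilon> p. 0 < \<epsilon> \<and> \<epsilon> < \<epsilon>\<^sub>0 \<and> p = p_crit CARD('n) + \<epsilon> \<longrightarrow>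
             (\<forall>x :: real ^ 'n. x \<noteq> 0 \<longrightarrow>
                barenblatt p x 1 M \<le> C * (\<epsilon> * norm x powr (- p)) powr (1 / (2 - p)))))
    \<and> (\<forall>r>0. uniform_limit {x :: real ^ 'n. norm x \<ge> r}
            (\<lambda>p x. barenblatt p x 1 M) (\<lambda>x. 0) (at_right (p_crit CARD('n))))"
proof (intro conjI)
  let ?c = "p_crit CARD('n)"
  note near = eventually_near_p_crit[OF N]
  show "\<forall>t>0. measures_tendsto
      (\<lambda>p. density lborel (\<lambda>x :: real ^ 'n. ennreal (barenblatt p x t M)))
      (scale_measure (ennreal M) (return borel 0)) (at_right ?c)"
  proof (intro allI impI measures_tendsto_dirac)
    fix t :: real assume t: "0 < t"
    show "\<forall>\<^sub>F p in at_right ?c. has_bochner_integral lborel (\<lambda>x::real^'n. barenblatt p x t M) M"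
      using near by eventually_elim (use barenblatt_const_props(2) N M t in blast)
    show "((\<lambda>p. \<integral>x. indicator {x::real^'n. r \<le> norm x} x * barenblatt p x t M \<partial>lborel) \<longlongrightarrow> 0)
        (at_right ?c)" if "0 < r" for r
      by (rule barenblatt_tail_tendsto_0[OF N M t that])
  qed (use M in \<open>auto simp: barenblatt_nonneg\<close>)
  show "\<exists>C>0. \<exists>\<epsilon>\<^sub>0>0. ?c + \<epsilon>\<^sub>0 \<le> 2 \<and>
      (\<forall>\<epsilon> p. 0 < \<epsilon> \<and> \<epsilon> < \<epsilon>\<^sub>0 \<and> p = ?c + \<epsilon> \<longrightarrow>
         (\<forall>x :: real ^ 'n. x \<noteq> 0 \<longrightarrow>
            barenblatt p x 1 M \<le> C * (\<epsilon> * norm x powr (- p)) powr (1 / (2 - p))))"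
  proof -
    \<comment> \<open>Continuity of the factor at the critical exponent bounds it by this constant nearby.\<close>
    define C where "C = barenblatt_factor CARD('n) ?c + 1"
    have C: "0 < C" by (simp add: C_def barenblatt_factor_def add_nonneg_pos)
    have "\<forall>\<^sub>F p in at_right ?c. barenblatt_factor CARD('n) p < C"
      by (rule order_tendstoD(2)[OF tendsto_barenblatt_factor[OF N]]) (simp add: C_def)
    then obtain b where b: "?c < b" "\<And>p. ?c < p \<Longrightarrow> p < b \<Longrightarrow> barenblatt_factor CARD('n) p < C"
      unfolding eventually_at_right_field by blast
    define \<epsilon>\<^sub>0 where "\<epsilon>\<^sub>0 = min b 2 - ?c"
    have \<epsilon>\<^sub>0: "0 < \<epsilon>\<^sub>0" "?c + \<epsilon>\<^sub>0 \<le> 2" using b(1) p_crit_bounds(2)[OF N] by (auto simp: \<epsilon>\<^sub>0_def)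
    have "barenblatt p x 1 M \<le> C * (\<epsilon> * norm x powr (- p)) powr (1 / (2 - p))"
      if "0 < \<epsilon>" "\<epsilon> < \<epsilon>\<^sub>0" and p: "p = ?c + \<epsilon>" and x: "x \<noteq> 0" for \<epsilon> p and x :: "real^'n"
    proof -
      have lt: "?c < p" "p < b" "p < 2" using that by (auto simp: \<epsilon>\<^sub>0_def)
      have "barenblatt p x 1 M \<le> barenblatt_factor CARD('n) p *
          (\<epsilon> * norm x powr (- p)) powr (1 / (2 - p))"
        using barenblatt_le[OF lt(1) lt(3) N M zero_less_one x] p by simp
      also have "\<dots> \<le> C * (\<epsilon> * norm x powr (- p)) powr (1 / (2 - p))"
        using b(2)[OF lt(1,2)] by (intro mult_right_mono) auto
      finally show ?thesis .
    qed
    with C \<epsilon>\<^sub>0 show ?thesis by blast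
  qed
  show "\<forall>r>0. uniform_limit {x :: real ^ 'n. norm x \<ge> r}
      (\<lambda>p x. barenblatt p x 1 M) (\<lambda>x. 0) (at_right ?c)"
    by (intro allI impI uniform_limit_barenblatt N M zero_less_one)
qed

end
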